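(* There exists a set $P$ of $n$ pairwise skew lines in $\mathbb{R}^3$ such that no subset of more than $O(n^{2/3})$ lines of $P$ is contained in a regulus, and no subset of more than $O(n^{1/3})$ lines of $P$ has the property that no $4$-subset of it is contained in a regulus.
   Context: Lines are pairwise skew if no two intersect and no two are parallel. A regulus is the surface in $\mathbb{R}^3$ which is the union of all lines intersecting three given pairwise skew lines (a hyperbolic paraboloid or a hyperboloid of one sheet); a line lies on a regulus if it is entirely contained in it. The constants in $O(\cdot)$ are absolute. *)

theory Defs
  imports "HOL-Analysis.Analysis"
begin

definition is_line :: "(real^3) set \<Rightarrow> bool" where
  "is_line L \<longleftrightarrow> affine L \<and> aff_dim L = 1"

definition skew :: "(real^3) set \<Rightarrow> (real^3) set \<Rightarrow> bool" where
  "skew L M \<longleftrightarrow> L \<inter> M = {} \<and> \<not> affine_parallel L M"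

text \<open>
  The closure is there because the lines live in affine space. If the three given lines lie on a
  hyperboloid of one sheet, then for each of them the opposite ruling has one line that is parallel
  to it, so does not intersect it; the bare union is therefore the hyperboloid with three lines
  removed, and does not contain the given lines. The closure puts these three lines back and yields
  the whole hyperboloid. For a hyperbolic paraboloid no such line exists, the union is the whole
  surface, and the closure changes nothing.
\<close>

definition is_regulus :: "(real^3) set \<Rightarrow> bool" where
  "is_regulus R \<longleftrightarrow>
     (\<exists>L1 L2 L3. is_line L1 \<and> is_line L2 \<and> is_line L3 \<and>
        skew L1 L2 \<and> skew L1 L3 \<and> skew L2 L3 \<and>
        R = closure (\<Union>{M. is_line M \<and> M \<inter> L1 \<noteq> {} \<and> M \<inter> L2 \<noteq> {} \<and> M \<inter> L3 \<noteq> {}}))"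

definition contained_in_regulus :: "(real^3) set set \<Rightarrow> bool" where
  "contained_in_regulus S \<longleftrightarrow> (\<exists>R. is_regulus R \<and> (\<forall>L\<in>S. L \<subseteq> R))"

end

theory Submission
  imports Defs
begin

text \<open>
  Each regulus lies on a quadric: ten coefficients, nine conditions. The lines of \<open>P\<close> are
  \<open>{x = t, z = t y + (t mod m)}\<close> for \<open>t < n\<close>, with \<open>m\<close> about \<open>n\<^sup>1\<^sup>/\<^sup>3\<close>; they lie in distinct parallel
  planes and have distinct slopes, so they are pairwise skew. The lines with \<open>t mod m = c\<close> rule the
  hyperbolic paraboloid \<open>z = x y + c\<close>, so a set without four lines in a regulus has at most three
  lines per class. Conversely, a quadric that contains more than two of the lines expresses \<open>t mod m\<close>
  as a quadratic polynomial in \<open>t\<close>, which limits their number to the size of one class or to \<open>2 m\<close>.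
\<close>

section \<open>Lines\<close>

lemma is_line_affine_hull:
  assumes "a \<noteq> b"
  shows "is_line (affine hull {a, b})"
  using assms by (simp add: is_line_def aff_dim_affine_hull aff_dim_2)

lemma line_eq_affine_hull:
  assumes L: "is_line L" and ab: "a \<in> L" "b \<in> L" "a \<noteq> b"
  shows "L = affine hull {a, b}"
proof -
  have "affine hull {a, b} \<subseteq> L"
    using L ab by (simp add: is_line_def hull_minimal)
  moreover have "aff_dim (affine hull {a, b}) = aff_dim L"
    using is_line_affine_hull[OF ab(3)] L by (simp add: is_line_def)
  ultimately show ?thesis
    using L affine_dim_equal[of "affine hull {a, b}" L]
    by (simp add: is_line_def)
qed

lemma is_line_param:
  "is_line L \<longleftrightarrow> (\<exists>u w. w \<noteq> 0 \<and> L = range (\<lambda>s. u + s *\<^sub>R w))"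
proof
  assume L: "is_line L"
  then have "L \<noteq> {}" "\<not> (\<exists>a. L = {a})"
    by (auto simp: is_line_def)
  then obtain a b where ab: "a \<in> L" "b \<in> L" "a \<noteq> b"
    by blast
  then show "\<exists>u w. w \<noteq> 0 \<and> L = range (\<lambda>s. u + s *\<^sub>R w)"
    using line_eq_affine_hull[OF L ab]
    by (intro exI[of _ a] exI[of _ "b - a"]) (simp add: affine_hull_2_alt)
next
  assume "\<exists>u w. w \<noteq> 0 \<and> L = range (\<lambda>s. u + s *\<^sub>R w)"
  then obtain u w where "w \<noteq> 0" "L = affine hull {u, u + w}"
    by (auto simp: affine_hull_2_alt)
  then show "is_line L"
    using is_line_affine_hull[of u "u + w"] by simp
qed

lemma line_three_points:
  assumes "is_line L"
  obtains p q r where "p \<in> L" "q \<in> L" "r \<in> L" "p \<noteq> q" "p \<noteq> r" "q \<noteq> r"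
proof -
  obtain u w where "w \<noteq> 0" "L = range (\<lambda>s. u + s *\<^sub>R w)"
    using assms is_line_param by blast
  then show thesis
    by (intro that[of "u + 0 *\<^sub>R w" "u + 1 *\<^sub>R w" "u + 2 *\<^sub>R w"])
      (auto simp del: scaleR_zero_left scaleR_one)
qed

section \<open>Quadrics\<close>

lemma quadratic_roots:
  fixes a b c :: real
  assumes "a \<noteq> 0 \<or> b \<noteq> 0 \<or> c \<noteq> 0"
  shows "finite {x. a + b * x + c * x\<^sup>2 = 0}" and "card {x. a + b * x + c * x\<^sup>2 = 0} \<le> 2"
proof -
  define p where "p = [:a, b, c:]"
  have "p \<noteq> 0" using assms by (auto simp: p_def)
  moreover have "{x. a + b * x + c * x\<^sup>2 = 0} = {x. poly p x = 0}"
    by (auto simp: p_def algebra_simps power2_eq_square)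
  moreover have "degree p \<le> 2" by (simp add: p_def)
  ultimately show "finite {x. a + b * x + c * x\<^sup>2 = 0}" "card {x. a + b * x + c * x\<^sup>2 = 0} \<le> 2"
    using poly_roots_finite[of p] card_poly_roots_bound[of p] by auto
qed

text \<open>Used to compare coefficients. The condition on \<open>T\<close> means "more than two
  elements, possibly infinitely many"; \<open>card T > 2\<close> would exclude \<open>UNIV\<close>,
  whose \<open>card\<close> is 0.\<close>

lemma quadratic_roots_subset:
  fixes a b c :: real
  assumes "\<And>x. x \<in> T \<Longrightarrow> a + b * x + c * x\<^sup>2 = 0" and "\<not> (finite T \<and> card T \<le> 2)"
  shows "a = 0 \<and> b = 0 \<and> c = 0"
proof (rule ccontr)
  assume "\<not> ?thesis"
  then have roots: "finite {x. a + b * x + c * x\<^sup>2 = 0}" "card {x. a + b * x + c * x\<^sup>2 = 0} \<le> 2"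
    using quadratic_roots[of a b c] by auto
  have "T \<subseteq> {x. a + b * x + c * x\<^sup>2 = 0}" using assms(1) by auto
  then show False
    using roots assms(2) card_mono finite_subset le_trans by meson
qed

text \<open>The Veronese map: the ten monomials of degree at most 2 form a vector of a
  ten-dimensional Euclidean space, so that a quadric becomes the preimage of a hyperplane and linear
  algebra applies.\<close>

definition monomials :: "real^3 \<Rightarrow> real \<times> (real^3) \<times> (real^3) \<times> (real^3)" where
  "monomials p = (1, p, vector [(p$1)\<^sup>2, (p$2)\<^sup>2, (p$3)\<^sup>2], vector [p$1 * p$2, p$1 * p$3, p$2 * p$3])"

definition quadric :: "real \<times> (real^3) \<times> (real^3) \<times> (real^3) \<Rightarrow> (real^3) set" where
  "quadric k = {p. k \<bullet> monomials p = 0}"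

lemma inner_monomials:
  "(j, g, d, e) \<bullet> monomials p = j + g$1 * p$1 + g$2 * p$2 + g$3 * p$3
     + d$1 * (p$1)\<^sup>2 + d$2 * (p$2)\<^sup>2 + d$3 * (p$3)\<^sup>2
     + e$1 * (p$1 * p$2) + e$2 * (p$1 * p$3) + e$3 * (p$2 * p$3)"
  by (simp add: monomials_def inner_vec_def sum_3)

text \<open>A regulus is a closure here, so a quadric that contains all the transversals must also
  absorb their limit points.\<close>

lemma closed_quadric: "closed (quadric k)"
proof -
  obtain j g d e where "k = (j, g, d, e)" by (metis prod.exhaust)
  then show ?thesis
    unfolding quadric_def
    by (simp add: inner_monomials) (intro closed_Collect_eq continuous_intros)
qed

lemma inner_monomials_line:
  obtains a b c where "\<And>s. k \<bullet> monomials (u + s *\<^sub>R w) = a + b * s + c * s\<^sup>2"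
proof -
  obtain j g d e where k: "k = (j, g, d, e)" by (metis prod.exhaust)
  define f where "f s = k \<bullet> monomials (u + s *\<^sub>R w)" for s
  \<comment> \<open>Interpolation at -1, 0 and 1 yields the coefficients without expanding the
    quadric equation along the line by hand.\<close>
  have "f s = f 0 + (f 1 - f (-1)) / 2 * s + ((f 1 + f (-1)) / 2 - f 0) * s\<^sup>2" for s
    unfolding f_def k inner_monomials
    by (simp add: field_simps power2_eq_square)
  then show thesis using that unfolding f_def by blast
qed

text \<open>Along a line the quadric equation is a polynomial of degree at most 2 in the parameter,
  and three roots make it vanish identically.\<close>

lemma line_subset_quadric:
  assumes L: "is_line L"
    and pqr: "p \<in> L" "q \<in> L" "r \<in> L" "p \<noteq> q" "p \<noteq> r" "q \<noteq> r"
    and Q: "p \<in> quadric k" "q \<in> quadric k" "r \<in> quadric k"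
  shows "L \<subseteq> quadric k"
proof -
  obtain u w where w: "L = range (\<lambda>s. u + s *\<^sub>R w)"
    using L is_line_param by blast
  obtain a b c where f: "\<And>s. k \<bullet> monomials (u + s *\<^sub>R w) = a + b * s + c * s\<^sup>2"
    using inner_monomials_line by blast
  obtain x y z where xyz: "p = u + x *\<^sub>R w" "q = u + y *\<^sub>R w" "r = u + z *\<^sub>R w"
    using pqr w by auto
  have "a = 0 \<and> b = 0 \<and> c = 0"
  proof (rule quadratic_roots_subset[of "{x, y, z}"])
    show "\<not> (finite {x, y, z} \<and> card {x, y, z} \<le> 2)"
      using pqr xyz by auto
    show "\<And>s. s \<in> {x, y, z} \<Longrightarrow> a + b * s + c * s\<^sup>2 = 0"
      using Q unfolding xyz quadric_def by (auto simp: f)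
  qed
  then show ?thesis by (auto simp: w quadric_def f)
qed

text \<open>Fewer than ten vectors cannot span a ten-dimensional space; a normal vector of a
  hyperplane through them is the coefficient vector.\<close>

lemma quadric_through_points:
  assumes "finite A" "card A < 10"
  obtains k where "k \<noteq> 0" "A \<subseteq> quadric k"
proof -
  have "dim (monomials ` A) \<le> card (monomials ` A)"
    using assms by (intro dim_le_card') auto
  also have "\<dots> < 10"
    using card_image_le[OF assms(1), of monomials] assms(2) by linarith
  finally have "dim (monomials ` A) < DIM(real \<times> (real^3) \<times> (real^3) \<times> (real^3))"
    by simp
  then obtain k where "k \<noteq> 0" "span (monomials ` A) \<subseteq> {x. k \<bullet> x = 0}"
    using lowdim_subset_hyperplane by blast
  then show thesis
    using that[of k] span_superset[of "monomials ` A"] by (auto simp: quadric_def)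
qed

text \<open>Nine points, three on each of the three lines, force the quadric to contain the lines;
  every transversal then meets it in three distinct points.\<close>

lemma regulus_subset_quadric:
  assumes "is_regulus R"
  obtains k where "k \<noteq> 0" "R \<subseteq> quadric k"
proof -
  obtain L1 L2 L3 where L: "is_line L1" "is_line L2" "is_line L3"
    and skew: "skew L1 L2" "skew L1 L3" "skew L2 L3"
    and R: "R = closure (\<Union>{M. is_line M \<and> M \<inter> L1 \<noteq> {} \<and> M \<inter> L2 \<noteq> {} \<and> M \<inter> L3 \<noteq> {}})"
    using assms unfolding is_regulus_def by blast
  obtain p1 q1 r1 where 1: "p1 \<in> L1" "q1 \<in> L1" "r1 \<in> L1" "p1 \<noteq> q1" "p1 \<noteq> r1" "q1 \<noteq> r1"
    using line_three_points[OF L(1)] .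
  obtain p2 q2 r2 where 2: "p2 \<in> L2" "q2 \<in> L2" "r2 \<in> L2" "p2 \<noteq> q2" "p2 \<noteq> r2" "q2 \<noteq> r2"
    using line_three_points[OF L(2)] .
  obtain p3 q3 r3 where 3: "p3 \<in> L3" "q3 \<in> L3" "r3 \<in> L3" "p3 \<noteq> q3" "p3 \<noteq> r3" "q3 \<noteq> r3"
    using line_three_points[OF L(3)] .
  \<comment> \<open>The length of the list bounds the cardinality by 9 whether or not some of the
    points coincide.\<close>
  have "card {p1, q1, r1, p2, q2, r2, p3, q3, r3} \<le> length [p1, q1, r1, p2, q2, r2, p3, q3, r3]"
    using card_length[of "[p1, q1, r1, p2, q2, r2, p3, q3, r3]"] by simp
  then have "finite {p1, q1, r1, p2, q2, r2, p3, q3, r3}" "card {p1, q1, r1, p2, q2, r2, p3, q3, r3} < 10"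
    by simp_all
  then obtain k where k: "k \<noteq> 0" "{p1, q1, r1, p2, q2, r2, p3, q3, r3} \<subseteq> quadric k"
    by (rule quadric_through_points)
  have sub: "L1 \<subseteq> quadric k" "L2 \<subseteq> quadric k" "L3 \<subseteq> quadric k"
    using line_subset_quadric[OF L(1) 1] line_subset_quadric[OF L(2) 2]
      line_subset_quadric[OF L(3) 3] k(2) by simp_all
  have "M \<subseteq> quadric k"
    if M: "is_line M" "M \<inter> L1 \<noteq> {}" "M \<inter> L2 \<noteq> {}" "M \<inter> L3 \<noteq> {}" for M
  proof -
    obtain p q r where pqr: "p \<in> M" "p \<in> L1" "q \<in> M" "q \<in> L2" "r \<in> M" "r \<in> L3"
      using M by blast
    have "p \<noteq> q" "p \<noteq> r" "q \<noteq> r"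
      using pqr skew unfolding skew_def by blast+
    then show ?thesis
      using line_subset_quadric[OF M(1), of p q r] pqr sub by blast
  qed
  then have "R \<subseteq> quadric k"
    unfolding R by (intro closure_minimal closed_quadric) blast
  then show thesis using that k(1) by blast
qed

section \<open>A ruling of the paraboloids \<open>z = x y + c\<close>\<close>

definition ruling_line :: "real \<Rightarrow> real \<Rightarrow> (real^3) set" where
  "ruling_line c t = range (\<lambda>y. vector [t, y, t * y + c])"

text \<open>The second ruling of \<open>z = x y + c\<close>, cut out by the planes
  \<open>y = s\<close>. Three of its lines serve to define the paraboloid as a regulus.\<close>

definition opposite_line :: "real \<Rightarrow> real \<Rightarrow> (real^3) set" where
  "opposite_line c s = range (\<lambda>x. vector [x, s, s * x + c])"

lemma is_line_ruling_line: "is_line (ruling_line c t)"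
  unfolding is_line_param
proof (intro exI conjI)
  show "vector [0, 1, t] \<noteq> (0 :: real^3)"
    by (simp add: vec_eq_iff forall_3)
  show "ruling_line c t = range (\<lambda>s. vector [t, 0, c] + s *\<^sub>R vector [0, 1, t])"
    unfolding ruling_line_def
    by (intro arg_cong[where f = range] ext) (simp add: vec_eq_iff forall_3)
qed

lemma is_line_opposite_line: "is_line (opposite_line c s)"
  unfolding is_line_param
proof (intro exI conjI)
  show "vector [1, 0, s] \<noteq> (0 :: real^3)"
    by (simp add: vec_eq_iff forall_3)
  show "opposite_line c s = range (\<lambda>x. vector [0, s, c] + x *\<^sub>R vector [1, 0, s])"
    unfolding opposite_line_def
    by (intro arg_cong[where f = range] ext) (simp add: vec_eq_iff forall_3)
qed

lemma mem_ruling_line: "p \<in> ruling_line c t \<longleftrightarrow> p$1 = t \<and> p$3 = t * p$2 + c"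
  by (auto simp: ruling_line_def image_iff vec_eq_iff forall_3)

lemma mem_opposite_line: "p \<in> opposite_line c s \<longleftrightarrow> p$2 = s \<and> p$3 = s * p$1 + c"
  by (auto simp: opposite_line_def image_iff vec_eq_iff forall_3)

text \<open>The lines lie in the distinct planes \<open>x = t\<close> and \<open>x = t'\<close>, and
  their directions \<open>(0, 1, t)\<close> and \<open>(0, 1, t')\<close> are not proportional. The
  offsets \<open>c\<close> and \<open>c'\<close> are arbitrary, so lines of different paraboloids
  are covered.\<close>

lemma skew_ruling_line:
  assumes "t \<noteq> t'"
  shows "skew (ruling_line c t) (ruling_line c' t')"
  unfolding skew_def
proof
  show "ruling_line c t \<inter> ruling_line c' t' = {}"
    using assms by (auto simp: mem_ruling_line)
  show "\<not> affine_parallel (ruling_line c t) (ruling_line c' t')"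
  proof
    assume "affine_parallel (ruling_line c t) (ruling_line c' t')"
    then obtain a where "ruling_line c' t' = (\<lambda>x. a + x) ` ruling_line c t"
      by (auto simp: affine_parallel_def)
    then have "a + vector [t, y, t * y + c] \<in> ruling_line c' t'" for y
      by (auto simp: ruling_line_def)
    \<comment> \<open>The difference of the two translated points is \<open>(0, 1, t)\<close>; it
      joins two points of a line of slope \<open>t'\<close>, hence \<open>t = t'\<close>.\<close>
    from this[of 0] this[of 1] show False
      using assms by (simp add: mem_ruling_line algebra_simps)
  qed
qed

lemma skew_opposite_line:
  assumes "s \<noteq> s'"
  shows "skew (opposite_line c s) (opposite_line c' s')"
  unfolding skew_def
proof
  show "opposite_line c s \<inter> opposite_line c' s' = {}"
    using assms by (auto simp: mem_opposite_line)
  show "\<not> affine_parallel (opposite_line c s) (opposite_line c' s')"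
  proof
    assume "affine_parallel (opposite_line c s) (opposite_line c' s')"
    then obtain a where "opposite_line c' s' = (\<lambda>x. a + x) ` opposite_line c s"
      by (auto simp: affine_parallel_def)
    then have "a + vector [x, s, s * x + c] \<in> opposite_line c' s'" for x
      by (auto simp: opposite_line_def)
    from this[of 0] this[of 1] show False
      using assms by (simp add: mem_opposite_line algebra_simps)
  qed
qed

text \<open>Every line of one ruling meets every line of the other, at
  \<open>(t, s, s t + c)\<close>, so it is a transversal of the opposite lines with
  \<open>s = 0, 1, 2\<close>.\<close>

lemma ruling_lines_contained_in_regulus: "contained_in_regulus (ruling_line c ` T)"
proof -
  let ?U = "\<Union>{M. is_line M \<and> M \<inter> opposite_line c 0 \<noteq> {} \<and> M \<inter> opposite_line c 1 \<noteq> {}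
    \<and> M \<inter> opposite_line c 2 \<noteq> {}}"
  have "is_regulus (closure ?U)"
    unfolding is_regulus_def
    by (rule exI[of _ "opposite_line c 0"], rule exI[of _ "opposite_line c 1"],
        rule exI[of _ "opposite_line c 2"])
      (simp add: is_line_opposite_line skew_opposite_line)
  moreover have "ruling_line c t \<subseteq> closure ?U" for t
  proof -
    have "ruling_line c t \<inter> opposite_line c s \<noteq> {}" for s
    proof -
      have "vector [t, s, s * t + c] \<in> ruling_line c t \<inter> opposite_line c s"
        by (simp add: mem_ruling_line mem_opposite_line)
      then show ?thesis by blast
    qed
    then have "ruling_line c t \<subseteq> ?U"
      by (intro Union_upper) (simp add: is_line_ruling_line)
    then show ?thesis using closure_subset by (rule order_trans)
  qed
  ultimately show ?thesis
    unfolding contained_in_regulus_def by (intro exI[of _ "closure ?U"]) auto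
qed

text \<open>Coefficients are compared twice: in \<open>y\<close> along each line, then in
  \<open>t\<close> over \<open>T\<close>. The coefficients of \<open>y^2\<close> and
  \<open>y\<close> remove all terms that are nonlinear in \<open>g t\<close>, so the constant
  coefficient can be solved for \<open>g t\<close>.\<close>

lemma ruling_lines_in_quadric:
  fixes g :: "real \<Rightarrow> real"
  assumes k: "k \<noteq> 0" and sub: "\<And>t. t \<in> T \<Longrightarrow> ruling_line (g t) t \<subseteq> quadric k"
    and T: "\<not> (finite T \<and> card T \<le> 2)"
  obtains a b c where "\<And>t. t \<in> T \<Longrightarrow> g t = a + b * t + c * t\<^sup>2"
proof -
  obtain j l d e where k': "k = (j, l, d, e)" by (metis prod.exhaust)
  have coeffs: "(j + l$1 * t + l$3 * g t + d$1 * t\<^sup>2 + d$3 * (g t)\<^sup>2 + e$2 * (t * g t) = 0)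
     \<and> (l$2 + l$3 * t + 2 * d$3 * t * g t + e$1 * t + e$2 * t\<^sup>2 + e$3 * g t = 0)
     \<and> (d$2 + d$3 * t\<^sup>2 + e$3 * t = 0)" if "t \<in> T" for t
  proof (rule quadratic_roots_subset[of UNIV])
    fix y :: real
    have "vector [t, y, t * y + g t] \<in> quadric k"
      using sub[OF that] by (auto simp: ruling_line_def)
    then show "(j + l$1 * t + l$3 * g t + d$1 * t\<^sup>2 + d$3 * (g t)\<^sup>2 + e$2 * (t * g t))
       + (l$2 + l$3 * t + 2 * d$3 * t * g t + e$1 * t + e$2 * t\<^sup>2 + e$3 * g t) * y
       + (d$2 + d$3 * t\<^sup>2 + e$3 * t) * y\<^sup>2 = 0"
      unfolding quadric_def k'
      by (simp add: inner_monomials algebra_simps power2_eq_square)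
  qed (simp add: infinite_UNIV_char_0)
  have 1: "d$2 = 0 \<and> e$3 = 0 \<and> d$3 = 0"
    using coeffs by (intro quadratic_roots_subset[OF _ T]) (simp add: algebra_simps)
  have 2: "l$2 = 0 \<and> l$3 + e$1 = 0 \<and> e$2 = 0"
    using coeffs 1 by (intro quadratic_roots_subset[OF _ T]) (simp add: algebra_simps)
  have 3: "j + l$1 * t + d$1 * t\<^sup>2 = - l$3 * g t" if "t \<in> T" for t
    using coeffs[OF that] 1 2 by (simp add: algebra_simps)
  \<comment> \<open>If the coefficient of \<open>z\<close> were 0, the constant coefficient would be
    a quadratic in \<open>t\<close> with more than two roots, and all ten coefficients would
    vanish.\<close>
  have nz: "l$3 \<noteq> 0"
  proof
    assume 0: "l$3 = 0"
    have "j = 0 \<and> l$1 = 0 \<and> d$1 = 0"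
      using 3 0 by (intro quadratic_roots_subset[OF _ T]) simp
    then have "k = 0"
      using 0 1 2 by (simp add: k' vec_eq_iff forall_3 zero_prod_def)
    then show False using k by simp
  qed
  show thesis
  proof (rule that[of "- j / l$3" "- l$1 / l$3" "- d$1 / l$3"])
    fix t assume "t \<in> T"
    then have "g t = - (j + l$1 * t + d$1 * t\<^sup>2) / l$3" using 3 nz by simp
    then show "g t = - j / l$3 + - l$1 / l$3 * t + - d$1 / l$3 * t\<^sup>2"
      by (simp add: diff_divide_distrib)
  qed
qed

section \<open>Counting\<close>

lemma card_le_fibres:
  assumes "finite T" "g ` T \<subseteq> {..<m::nat}" "\<And>c. c < m \<Longrightarrow> card {t \<in> T. g t = c} \<le> k"
  shows "card T \<le> m * k"
proof -
  have "T = (\<Union>c<m. {t \<in> T. g t = c})"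
    using assms(2) by auto
  then have "card T = card (\<Union>c<m. {t \<in> T. g t = c})"
    by simp
  also have "\<dots> \<le> (\<Sum>c<m. card {t \<in> T. g t = c})"
    by (rule card_UN_le) simp
  also have "\<dots> \<le> m * k"
    using sum_bounded_above[of "{..<m}" "\<lambda>c. card {t \<in> T. g t = c}" k] assms(3) by simp
  finally show ?thesis .
qed

text \<open>Within a residue class, \<open>t\<close> is determined by its quotient
  \<open>t div m\<close>, which is one of \<open>0, ..., n div m\<close>.\<close>

lemma card_residue_class_le: "card {t \<in> {..<n::nat}. t mod m = c} \<le> n div m + 1"
proof -
  have "inj_on (\<lambda>t. t div m) {t \<in> {..<n}. t mod m = c}"
    by (rule inj_onI) (metis (mono_tags, lifting) div_mult_mod_eq mem_Collect_eq)
  then have "card {t \<in> {..<n}. t mod m = c} \<le> card {..n div m}"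
    by (rule card_inj_on_le) (auto intro: div_le_mono)
  then show ?thesis by simp
qed

text \<open>If a quadratic polynomial takes the value \<open>t mod m\<close> at every \<open>t \<in> T\<close>, then it is constant, so
  that \<open>T\<close> lies in one residue class, or it takes each of the \<open>m\<close> values at most twice.\<close>

lemma card_ruling_lines_in_regulus:
  assumes m: "m > 0" and T: "T \<subseteq> {..<n}"
    and reg: "contained_in_regulus ((\<lambda>t. ruling_line (real (t mod m)) (real t)) ` T)"
  shows "card T \<le> max (2 * m) (n div m + 1)"
proof (cases "card T \<le> 2")
  case True
  then show ?thesis using m by simp
next
  case False
  have fin: "finite T" using T finite_subset by blast
  \<comment> \<open>The offset \<open>t mod m\<close> has to be a function of a real argument;
    rounding down extends it from the naturals.\<close>
  define g where "g x = real (nat \<lfloor>x\<rfloor> mod m)" for x :: real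
  have g: "g (real t) = real (t mod m)" for t by (simp add: g_def)
  have cT: "card (real ` T) = card T" by (simp add: card_image)
  obtain R where R: "is_regulus R" "\<And>t. t \<in> T \<Longrightarrow> ruling_line (g (real t)) (real t) \<subseteq> R"
    using reg unfolding contained_in_regulus_def g by auto
  obtain k where k: "k \<noteq> 0" "R \<subseteq> quadric k"
    using regulus_subset_quadric[OF R(1)] .
  obtain a b c where abc: "\<And>t. t \<in> real ` T \<Longrightarrow> g t = a + b * t + c * t\<^sup>2"
  proof (rule ruling_lines_in_quadric[OF k(1), of "real ` T" g])
    show "ruling_line (g t) t \<subseteq> quadric k" if "t \<in> real ` T" for t
      using that R(2) k(2) by blast
    show "\<not> (finite (real ` T) \<and> card (real ` T) \<le> 2)"
      using False cT by simp
  qed blast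
  show ?thesis
  proof (cases "b = 0 \<and> c = 0")
    case True
    \<comment> \<open>The constant \<open>a\<close> equals \<open>t mod m\<close> for every
      \<open>t\<close> in \<open>T\<close>, so rounding only turns it back into a natural
      number.\<close>
    have "T \<subseteq> {t \<in> {..<n}. t mod m = nat \<lfloor>a\<rfloor>}"
    proof
      fix t assume t: "t \<in> T"
      then have "real (t mod m) = a" using abc[of "real t"] True by (simp add: g)
      then show "t \<in> {t \<in> {..<n}. t mod m = nat \<lfloor>a\<rfloor>}" using t T by auto
    qed
    then have "card T \<le> card {t \<in> {..<n}. t mod m = nat \<lfloor>a\<rfloor>}"
      by (intro card_mono) auto
    then show ?thesis using card_residue_class_le[of n m "nat \<lfloor>a\<rfloor>"] by simp
  next
    case nc: False
    have "card T \<le> m * 2"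
    proof (rule card_le_fibres[OF fin])
      show "(\<lambda>t. t mod m) ` T \<subseteq> {..<m}" using m by auto
      fix r
      have "\<not> (a - real r = 0 \<and> b = 0 \<and> c = 0)" using nc by blast
      moreover have "(a - real r) + b * x + c * x\<^sup>2 = 0"
        if "x \<in> real ` {t \<in> T. t mod m = r}" for x
        using that abc[of x] by (auto simp: g)
      ultimately have "card (real ` {t \<in> T. t mod m = r}) \<le> 2"
        using quadratic_roots_subset by blast
      then show "card {t \<in> T. t mod m = r} \<le> 2" by (simp add: card_image)
    qed
    then show ?thesis by simp
  qed
qed

text \<open>Lines with the same residue \<open>c\<close> share the paraboloid
  \<open>z = x y + c\<close>, so each of the \<open>m\<close> classes contributes at most three.
  Injectivity ensures that four indices give four lines.\<close>

lemma card_no_four_in_regulus: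
  assumes m: "m > 0" and fin: "finite T"
    and inj: "inj_on (\<lambda>t. ruling_line (real (t mod m)) (real t)) T"
    and no4: "\<forall>U \<subseteq> (\<lambda>t. ruling_line (real (t mod m)) (real t)) ` T. card U = 4 \<longrightarrow> \<not> contained_in_regulus U"
  shows "card T \<le> m * 3"
proof (rule card_le_fibres[OF fin])
  show "(\<lambda>t. t mod m) ` T \<subseteq> {..<m}" using m by auto
  fix c
  show "card {t \<in> T. t mod m = c} \<le> 3"
  proof (rule ccontr)
    assume "\<not> ?thesis"
    then have "4 \<le> card {t \<in> T. t mod m = c}" by simp
    then obtain V where V: "V \<subseteq> {t \<in> T. t mod m = c}" "card V = 4"
      by (meson obtain_subset_with_card_n)
    let ?U = "(\<lambda>t. ruling_line (real (t mod m)) (real t)) ` V"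
    have "card ?U = 4"
      using V card_image[OF inj_on_subset[OF inj, of V]] by auto
    moreover have "?U = ruling_line (real c) ` real ` V"
      using V(1) by (auto simp: image_iff)
    then have "contained_in_regulus ?U"
      by (simp add: ruling_lines_contained_in_regulus)
    moreover have "?U \<subseteq> (\<lambda>t. ruling_line (real (t mod m)) (real t)) ` T"
      using V(1) by auto
    ultimately show False using no4 by blast
  qed
qed

theorem theorem27:
  "\<exists>C1 > 0. \<exists>C2 > 0. \<forall>n :: nat. \<exists>P :: (real^3) set set.
     finite P \<and> card P = n \<and> (\<forall>L\<in>P. is_line L) \<and> pairwise skew P \<and>
     (\<forall>S\<subseteq>P. contained_in_regulus S \<longrightarrow> real (card S) \<le> C1 * real n powr (2/3)) \<and>
     (\<forall>S\<subseteq>P. (\<forall>T\<subseteq>S. card T = 4 \<longrightarrow> \<not> contained_in_regulus T) \<longrightarrow>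
        real (card S) \<le> C2 * real n powr (1/3))"
proof (rule exI[of _ 4], intro conjI, simp, rule exI[of _ 6], intro conjI, simp, intro allI)
  fix n :: nat
  define x where "x = real n powr (1/3)"
  \<comment> \<open>The bounds \<open>3 m\<close> and \<open>n div m + 1\<close> force
    \<open>m\<close> to be of order \<open>n powr (1/3)\<close>. Rounding up gives
    \<open>x <= m <= 2 x\<close> for \<open>n > 0\<close>. Hence \<open>3 m <= 6 x\<close>, which is
    the constant 6, and \<open>2 m <= 4 x <= 4 x^2\<close>, which is the constant 4.\<close>
  define m where "m = nat \<lceil>x\<rceil>"
  define line where "line t = ruling_line (real (t mod m)) (real t)" for t
  have sk: "skew (line s) (line t)" if "s \<noteq> t" for s t
    unfolding line_def using that by (intro skew_ruling_line) simp
  have ne: "line t \<noteq> {}" for t by (simp add: line_def ruling_line_def)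
  \<comment> \<open>If two indices gave the same line, skewness would make it disjoint from itself,
    hence empty.\<close>
  have inj: "inj line"
    using sk ne by (intro injI) (metis Int_absorb skew_def)
  have x1: "x \<ge> 1" if "n > 0"
    using that by (simp add: x_def ge_one_powr_ge_zero)
  have m0: "m > 0" if "n > 0" using x1[OF that] by (simp add: m_def)
  have x2: "x\<^sup>2 = real n powr (2/3)"
    by (simp add: x_def power2_eq_square flip: powr_add)
  have x3: "x ^ 3 = real n"
  proof (cases "n = 0")
    case False
    then have "x ^ 3 = x powr real 3" by (subst powr_realpow) (auto simp: x_def)
    also have "\<dots> = real n powr (1/3 * real 3)" unfolding x_def by (rule powr_powr)
    finally show ?thesis by simp
  qed (simp add: x_def)
  have mx: "x \<le> real m" "real m \<le> 2 * x" if "n > 0"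
    using x1[OF that] unfolding m_def by linarith+
  show "\<exists>P :: (real^3) set set.
     finite P \<and> card P = n \<and> (\<forall>L\<in>P. is_line L) \<and> pairwise skew P \<and>
     (\<forall>S\<subseteq>P. contained_in_regulus S \<longrightarrow> real (card S) \<le> 4 * real n powr (2/3)) \<and>
     (\<forall>S\<subseteq>P. (\<forall>T\<subseteq>S. card T = 4 \<longrightarrow> \<not> contained_in_regulus T) \<longrightarrow>
        real (card S) \<le> 6 * real n powr (1/3))"
  proof (intro exI[of _ "line ` {..<n}"] conjI allI impI)
    show "finite (line ` {..<n})" by simp
    show "card (line ` {..<n}) = n"
      using inj by (simp add: card_image inj_on_subset)
    show "\<forall>L\<in>line ` {..<n}. is_line L"
      by (auto simp: line_def is_line_ruling_line)
    show "pairwise skew (line ` {..<n})"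
      by (rule pairwise_imageI) (rule sk)
  next
    fix S assume S: "S \<subseteq> line ` {..<n}" and reg: "contained_in_regulus S"
    obtain T where T: "T \<subseteq> {..<n}" "S = line ` T" by (rule subset_imageE[OF S])
    have cS: "card S = card T"
      using inj T by (simp add: card_image inj_on_subset)
    show "real (card S) \<le> 4 * real n powr (2/3)"
    \<comment> \<open>For \<open>n = 0\<close> the family is empty; otherwise \<open>x >= 1\<close>,
      which lets \<open>x\<close> and 1 be absorbed into \<open>x^2\<close>.\<close>
    proof (cases "n = 0")
      case True
      then show ?thesis using S by simp
    next
      case False
      have "contained_in_regulus ((\<lambda>t. ruling_line (real (t mod m)) (real t)) ` T)"
        using reg unfolding T(2) line_def .
      then have "card T \<le> max (2 * m) (n div m + 1)"
        using m0 False T(1) by (intro card_ruling_lines_in_regulus) auto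
      moreover have "real (2 * m) \<le> 4 * x\<^sup>2"
      proof -
        have "x \<le> x\<^sup>2" using x1 False by (intro self_le_power) auto
        then show ?thesis using mx(2) False by simp
      qed
      moreover have "real (n div m + 1) \<le> 4 * x\<^sup>2"
      proof -
        have "real (n div m) \<le> real n / real m" by (rule of_nat_div_le_of_nat)
        also have "\<dots> \<le> real n / x"
          using mx x1 False by (intro divide_left_mono) auto
        also have "\<dots> = x\<^sup>2"
          using x1 False unfolding x3[symmetric] by (simp add: power2_eq_square power3_eq_cube)
        finally have "real (n div m) \<le> x\<^sup>2" .
        moreover have "1 \<le> x\<^sup>2" using x1 False by (intro one_le_power) simp
        ultimately show ?thesis by simp
      qed
      ultimately show ?thesis unfolding cS x2[symmetric] by linarith
    qed
  next
    fix S assume S: "S \<subseteq> line ` {..<n}"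
      and no4: "\<forall>T\<subseteq>S. card T = 4 \<longrightarrow> \<not> contained_in_regulus T"
    obtain T where T: "T \<subseteq> {..<n}" "S = line ` T" by (rule subset_imageE[OF S])
    have cS: "card S = card T"
      using inj T by (simp add: card_image inj_on_subset)
    show "real (card S) \<le> 6 * real n powr (1/3)"
    proof (cases "n = 0")
      case True
      then show ?thesis using S by simp
    next
      case False
      have "card T \<le> m * 3"
      proof (rule card_no_four_in_regulus)
        show "m > 0" using m0 False by simp
        show "finite T" using T(1) finite_subset by blast
        show "inj_on (\<lambda>t. ruling_line (real (t mod m)) (real t)) T"
          using inj_on_subset[OF inj subset_UNIV] unfolding line_def .
        show "\<forall>U \<subseteq> (\<lambda>t. ruling_line (real (t mod m)) (real t)) ` T.
            card U = 4 \<longrightarrow> \<not> contained_in_regulus U"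
          using no4 unfolding T(2) line_def .
      qed
      then have "real (card T) \<le> 3 * real m" by linarith
      then show ?thesis using mx(2) False unfolding cS x_def[symmetric] by linarith
    qed
  qed
qed

end
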